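(* Let $0<s<m$ and let $\boldsymbol F[\boldsymbol u]_{t,\boldsymbol x}=\boldsymbol 0$ ($t\in\mathcal I$, $\boldsymbol x\in\Omega$) be a system of $m$ PDEs with an $s\times m$ matrix $\Lambda=(\widetilde\Lambda\ \ \Sigma)$ of conservation law multipliers ($\widetilde\Lambda$ of size $s\times s$, $\Sigma$ of size $s\times(m-s)$), densities $\boldsymbol\psi=(\psi^1,\dots,\psi^s)^T$ and fluxes $\Phi=(\phi^{ji})_{1\le j\le s,\,1\le i\le n}$; let $\boldsymbol G$ be the last $m-s$ entries of $\boldsymbol F$. Let $\widetilde\Lambda^{\tau,h},\Sigma^{\tau,h},\boldsymbol G^{\tau,h},\boldsymbol\psi^{\tau,h},\Phi^{\tau,h}=(\phi^{ji,\tau,h})$ be finite difference discretizations of $\widetilde\Lambda,\Sigma,\boldsymbol G,\boldsymbol\psi,\Phi$, and define $$D_t^{\tau,h}\boldsymbol\psi\{\boldsymbol u^{\tau,h}\}_{k,J}=\frac{\boldsymbol\psi^{\tau,h}\{\boldsymbol u^{\tau,h}\}_{k,J}-\boldsymbol\psi^{\tau,h}\{\boldsymbol u^{\tau,h}\}_{k-1,J}}{\tau},$$ $$\left(D_{\boldsymbol x}^{\tau,h}\cdot\Phi\right)^j\{\boldsymbol u^{\tau,h}\}_{k,J}=\sum_{i=1}^n\frac{\phi^{ji,\tau,h}\{\boldsymbol u^{\tau,h}\}_{k,J}-\phi^{ji,\tau,h}\{\boldsymbol u^{\tau,h}\}_{k,J-\hat i}}{h},$$ $$\boldsymbol F^{\tau,h}\{\boldsymbol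 u^{\tau,h}\}:=\begin{pmatrix}(\widetilde\Lambda^{\tau,h})^{-1}\{\boldsymbol u^{\tau,h}\}\left(D_t^{\tau,h}\boldsymbol\psi\{\boldsymbol u^{\tau,h}\}+D_{\boldsymbol x}^{\tau,h}\cdot\Phi\{\boldsymbol u^{\tau,h}\}-\Sigma^{\tau,h}\{\boldsymbol u^{\tau,h}\}\boldsymbol G^{\tau,h}\{\boldsymbol u^{\tau,h}\}\right)\\ \boldsymbol G^{\tau,h}\{\boldsymbol u^{\tau,h}\}\end{pmatrix}$$ (with $\widetilde\Lambda^{\tau,h}\{\boldsymbol u^{\tau,h}\}$ assumed invertible on the mesh). Let $\boldsymbol u^{\tau,h}:\mathcal I^\tau\times\Omega^h\to\mathbb R^m$ be a solution to the discrete problem $\boldsymbol F^{\tau,h}\{\boldsymbol u^{\tau,h}\}_{k,J}=\boldsymbol 0$, $\boldsymbol x_J\in\Omega^h$. If the discretized fluxes $\Phi^{\tau,h}\{\boldsymbol u^{\tau,h}\}$ vanish on the boundary $\partial\Omega^h$, then $$\sum_{\boldsymbol x_J\in\Omega^h}\boldsymbol\psi^{\tau,h}\{\boldsymbol u^{\tau,h}\}_{k,J}=\sum_{\boldsymbol x_J\in\Omega^h}\boldsymbol\psi^{\tau,h}\{\boldsymbol u^{\tau,h}\}_{k-1,J}.$$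
   Context: $\mathcal I=(0,T)$, $\Omega\subset\mathbb R^n$ is a bounded domain, $\mathcal I^\tau=\{k\tau:k=0,\dots,\lfloor T/\tau\rfloor\}$ with points $t_k=k\tau$, and $\Omega^h=\Omega\cap h\mathbb Z^n$ with mesh points $\boldsymbol x_J=(x_{j_1},\dots,x_{j_n})$, $J=(j_1,\dots,j_n)\in\mathbb Z^n$; $\hat i$ is the multi-index with $1$ in the $i$-th component and $0$ elsewhere. It is assumed that $h$ is sufficiently small that the discretization error of $\partial\Omega$ by $\partial\Omega^h$ is negligible. $\boldsymbol F[\boldsymbol u]_{t,\boldsymbol x}$ denotes the value at $(t,\boldsymbol x)$ of an $\mathbb R^m$-valued function of $t,\boldsymbol x,\boldsymbol u$ and finitely many partial derivatives of $\boldsymbol u=(u^1,\dots,u^m)$. $\Lambda$ is a matrix of conservation law multipliers with densities $\boldsymbol\psi$ and fluxes $\Phi$ if $\Lambda[\boldsymbol u]\boldsymbol F[\boldsymbol u]=D_t\boldsymbol\psi[\boldsymbol u]+D_{\boldsymbol x}\cdot\Phi[\boldsymbol u]$ identically, where $(D_{\boldsymbol x}\cdot\Phi)^j=\sum_iD_{x_i}\phi^{ji}$ and $D_t,D_{x_i}$ are total derivatives. A finite difference discretization is an expression whose value at $(t_k,\boldsymbol x_J)$, written with subscript $k,J$, depends on $t_k,\boldsymbol x_J$ and mesh values of its argument. Boundary: for a mesh multi-index $J$ and fixed $J_i=(j_1,\dots,j_{i-1},j_{i+1},\dots,j_n)$, the index $j_i$ ranges over a union of $M_{J_i}$ sets of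 consecutive indices $\{\alpha_{J_i,l},\alpha_{J_i,l}+1,\dots,\beta_{J_i,l}\}$, $l=1,\dots,M_{J_i}$. The boundary is $\partial\Omega^h=\bigcup_{i=1}^n\{\boldsymbol x_J\in\Omega^h: \text{for some } l\in\{1,\dots,M_{J_i}\},\ j_i=\alpha_{J_i,l}\text{ or }\beta_{J_i,l}\}$.
   Formalization: The flux at J−î is undefined when that neighbour lies off the mesh, and the claim fails if it is arbitrary; it is assumed that there the i-th flux equals that at the adjacent boundary point J, hence is zero when the fluxes vanish on the boundary. *)

theory Defs
  imports "HOL-Analysis.Analysis"
begin

section \<open>Differential functions, total derivatives and multipliers\<close>

text \<open>
  A multi-index counts differentiations in \<open>t\<close> (\<open>None\<close>) and in \<open>x\<^sub>i\<close> (\<open>Some i\<close>).  A jet assigns to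
  every multi-index \<open>\<alpha>\<close> an independent value for \<open>\<partial>\<^sup>\<alpha> u\<close>; the value at \<open>\<alpha> = 0\<close> is \<open>u\<close> itself.
  A function \<open>f t x z\<close> of a jet \<open>z\<close> stands for \<open>f[u]\<close> at \<open>(t, x)\<close>.
\<close>

type_synonym 'n multi_index = "'n option \<Rightarrow> nat"
type_synonym ('n, 'm) jet = "'n multi_index \<Rightarrow> real ^ 'm"
type_synonym ('n, 'm, 'v) dfun = "real \<Rightarrow> real ^ 'n \<Rightarrow> ('n, 'm) jet \<Rightarrow> 'v"

definition differential_function :: "('n::finite, 'm::finite, 'v) dfun \<Rightarrow> bool" where
  "differential_function f \<longleftrightarrow>
    (\<exists>S. finite S \<and> (\<forall>t x z w. (\<forall>\<alpha>\<in>S. z \<alpha> = w \<alpha>) \<longrightarrow> f t x z = f t x w))"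

definition jet_support :: "('n::finite, 'm::finite, real) dfun \<Rightarrow> 'n multi_index set" where
  "jet_support f = {\<alpha>. \<exists>t x z v. f t x (z(\<alpha> := v)) \<noteq> f t x z}"

fun base_line :: "'n option \<Rightarrow> ('n::finite, 'm::finite, real) dfun \<Rightarrow> real \<Rightarrow> real ^ 'n
    \<Rightarrow> ('n, 'm) jet \<Rightarrow> real \<Rightarrow> real" where
  "base_line None f t x z = (\<lambda>r. f (t + r) x z)"
| "base_line (Some i) f t x z = (\<lambda>r. f t (x + r *\<^sub>R axis i 1) z)"

definition jet_line :: "'n multi_index \<Rightarrow> 'm \<Rightarrow> ('n::finite, 'm::finite, real) dfun \<Rightarrow> real
    \<Rightarrow> real ^ 'n \<Rightarrow> ('n, 'm) jet \<Rightarrow> real \<Rightarrow> real" where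
  "jet_line \<alpha> c f t x z = (\<lambda>r. f t x (z(\<alpha> := z \<alpha> + r *\<^sub>R axis c 1)))"

definition has_partials_on :: "real set \<Rightarrow> (real ^ 'n) set \<Rightarrow> ('n::finite, 'm::finite, real) dfun \<Rightarrow> bool"
  where
  "has_partials_on I \<Omega> f \<longleftrightarrow>
    (\<forall>t\<in>I. \<forall>x\<in>\<Omega>. \<forall>z.
       (\<forall>d. base_line d f t x z field_differentiable at 0) \<and>
       (\<forall>\<alpha> c. jet_line \<alpha> c f t x z field_differentiable at 0))"

definition total_deriv :: "'n option \<Rightarrow> ('n::finite, 'm::finite, real) dfun \<Rightarrow> ('n, 'm, real) dfun" where
  "total_deriv d f t x z =
    deriv (base_line d f t x z) 0 +
    (\<Sum>\<alpha>\<in>jet_support f. \<Sum>c\<in>UNIV.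
       z (\<alpha>(d := Suc (\<alpha> d))) $ c * deriv (jet_line \<alpha> c f t x z) 0)"

definition conservation_law_multipliers ::
  "real set \<Rightarrow> (real ^ 'n) set \<Rightarrow> ('n::finite, 'm::finite, real ^ 'm ^ 's) dfun \<Rightarrow>
    ('n, 'm, real ^ 'm) dfun \<Rightarrow> ('n, 'm, real ^ 's) dfun \<Rightarrow> ('n, 'm, real ^ 'n ^ 's::finite) dfun \<Rightarrow> bool"
  where
  "conservation_law_multipliers I \<Omega> \<Lambda> F \<psi> \<Phi> \<longleftrightarrow>
    differential_function \<Lambda> \<and> differential_function \<psi> \<and> differential_function \<Phi> \<and>
    (\<forall>j. has_partials_on I \<Omega> (\<lambda>t x z. \<psi> t x z $ j)) \<and>
    (\<forall>j i. has_partials_on I \<Omega> (\<lambda>t x z. \<Phi> t x z $ j $ i)) \<and>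
    (\<forall>t\<in>I. \<forall>x\<in>\<Omega>. \<forall>z.
       \<Lambda> t x z *v F t x z =
       (\<chi> j. total_deriv None (\<lambda>t x z. \<psi> t x z $ j) t x z +
             (\<Sum>i\<in>UNIV. total_deriv (Some i) (\<lambda>t x z. \<Phi> t x z $ j $ i) t x z)))"

text \<open>
  The index type \<open>'s + 'r\<close> encodes \<open>m = s + (m - s)\<close> with \<open>0 < s < m\<close>: \<open>Inl\<close> indexes the first
  \<open>s\<close> entries and \<open>Inr\<close> the last \<open>m - s\<close> entries.
\<close>

definition block_row :: "real ^ 's ^ 's \<Rightarrow> real ^ 'r ^ 's \<Rightarrow> real ^ ('s::finite + 'r::finite) ^ 's" where
  "block_row A B = (\<chi> j c. case c of Inl a \<Rightarrow> A $ j $ a | Inr b \<Rightarrow> B $ j $ b)"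

definition block_vec :: "real ^ 's \<Rightarrow> real ^ 'r \<Rightarrow> real ^ ('s::finite + 'r::finite)" where
  "block_vec v w = (\<chi> c. case c of Inl a \<Rightarrow> v $ a | Inr b \<Rightarrow> w $ b)"

definition last_entries :: "real ^ ('s::finite + 'r::finite) \<Rightarrow> real ^ 'r" where
  "last_entries v = (\<chi> b. v $ Inr b)"


section \<open>Meshes\<close>

text \<open>Mesh points are represented by their indices \<open>k\<close> and \<open>J\<close>.\<close>

definition mesh_point :: "real \<Rightarrow> int ^ 'n \<Rightarrow> real ^ 'n::finite" where
  "mesh_point h J = (\<chi> i. h * of_int (J $ i))"

definition time_mesh :: "real \<Rightarrow> real \<Rightarrow> nat set" where
  "time_mesh T \<tau> = {0..nat \<lfloor>T / \<tau>\<rfloor>}"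

definition space_mesh :: "(real ^ 'n) set \<Rightarrow> real \<Rightarrow> (int ^ 'n::finite) set" where
  "space_mesh \<Omega> h = {J. mesh_point h J \<in> \<Omega>}"

text \<open>The values of \<open>j\<^sub>i\<close> for which the index with the other components of \<open>J\<close> is in the mesh.\<close>

definition mesh_line :: "(real ^ 'n) set \<Rightarrow> real \<Rightarrow> 'n \<Rightarrow> int ^ 'n::finite \<Rightarrow> int set" where
  "mesh_line \<Omega> h i J = {j. (\<chi> p. if p = i then j else J $ p) \<in> space_mesh \<Omega> h}"

text \<open>End points \<open>(\<alpha>, \<beta>)\<close> of the maximal sets of consecutive integers in \<open>S\<close>.\<close>

definition runs :: "int set \<Rightarrow> (int \<times> int) set" where
  "runs S = {(\<alpha>, \<beta>). \<alpha> \<le> \<beta> \<and> {\<alpha>..\<beta>} \<subseteq> S \<and> \<alpha> - 1 \<notin> S \<and> \<beta> + 1 \<notin> S}"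

definition mesh_boundary :: "(real ^ 'n) set \<Rightarrow> real \<Rightarrow> (int ^ 'n::finite) set" where
  "mesh_boundary \<Omega> h =
    (\<Union>i. {J \<in> space_mesh \<Omega> h. \<exists>(\<alpha>, \<beta>) \<in> runs (mesh_line \<Omega> h i J). J $ i = \<alpha> \<or> J $ i = \<beta>})"


section \<open>Discretizations\<close>

type_synonym ('n, 'm) mesh_fun = "nat \<Rightarrow> int ^ 'n \<Rightarrow> real ^ 'm"
type_synonym ('n, 'm, 'v) mesh_expr = "('n, 'm) mesh_fun \<Rightarrow> nat \<Rightarrow> int ^ 'n \<Rightarrow> 'v"

text \<open>
  Indices range over all of \<open>nat\<close> and \<open>int ^ 'n\<close> because the difference quotients below refer to
  neighbours of mesh points, which need not be mesh points; the argument, however, enters only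
  through its values on the mesh.
\<close>

definition fd_discretization ::
  "real \<Rightarrow> real \<Rightarrow> (real ^ 'n) set \<Rightarrow> real \<Rightarrow> ('n::finite, 'm::finite, 'v) mesh_expr \<Rightarrow> bool" where
  "fd_discretization T \<tau> \<Omega> h A \<longleftrightarrow>
    (\<forall>u v. (\<forall>k\<in>time_mesh T \<tau>. \<forall>J\<in>space_mesh \<Omega> h. u k J = v k J) \<longrightarrow>
       (\<forall>k J. A u k J = A v k J))"

definition disc_Dt :: "real \<Rightarrow> ('n::finite, 'm::finite, real ^ 's::finite) mesh_expr
    \<Rightarrow> ('n, 'm, real ^ 's) mesh_expr" where
  "disc_Dt \<tau> \<psi> u k J = (\<psi> u k J - \<psi> u (k - 1) J) /\<^sub>R \<tau>"

definition disc_div :: "real \<Rightarrow> ('n::finite, 'm::finite, real ^ 'n ^ 's::finite) mesh_expr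
    \<Rightarrow> ('n, 'm, real ^ 's) mesh_expr" where
  "disc_div h \<Phi> u k J =
    (\<chi> j. \<Sum>i\<in>UNIV. (\<Phi> u k J $ j $ i - \<Phi> u k (J - axis i 1) $ j $ i) / h)"

definition disc_F ::
  "real \<Rightarrow> real \<Rightarrow> ('n::finite, 's::finite + 'r::finite, real ^ 's ^ 's) mesh_expr \<Rightarrow>
    ('n, 's + 'r, real ^ 'r ^ 's) mesh_expr \<Rightarrow> ('n, 's + 'r, real ^ 'r) mesh_expr \<Rightarrow>
    ('n, 's + 'r, real ^ 's) mesh_expr \<Rightarrow> ('n, 's + 'r, real ^ 'n ^ 's) mesh_expr \<Rightarrow>
    ('n, 's + 'r, real ^ ('s + 'r)) mesh_expr" where
  "disc_F \<tau> h L S G \<psi> \<Phi> u k J =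
    block_vec
      (matrix_inv (L u k J) *v
         (disc_Dt \<tau> \<psi> u k J + disc_div h \<Phi> u k J - S u k J *v G u k J))
      (G u k J)"

definition fluxes_vanish_on_boundary ::
  "(real ^ 'n) set \<Rightarrow> real \<Rightarrow> ('n::finite, 'm::finite, real ^ 'n ^ 's::finite) mesh_expr \<Rightarrow>
    ('n, 'm) mesh_fun \<Rightarrow> nat \<Rightarrow> bool" where
  "fluxes_vanish_on_boundary \<Omega> h \<Phi> u k \<longleftrightarrow> (\<forall>J\<in>mesh_boundary \<Omega> h. \<Phi> u k J = 0)"

text \<open>
  At a mesh point whose backward neighbour in direction \<open>i\<close> lies outside \<open>\<Omega>\<close>, the true boundary
  lies between the two.  That replacing it by the mesh boundary causes no error is expressed by
  the outward neighbour carrying the same flux in direction \<open>i\<close> as the adjacent boundary point.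
  Without such a condition the outside value is unconstrained and enters the discrete divergence.
\<close>

definition boundary_error_negligible ::
  "(real ^ 'n) set \<Rightarrow> real \<Rightarrow> ('n::finite, 'm::finite, real ^ 'n ^ 's::finite) mesh_expr \<Rightarrow>
    ('n, 'm) mesh_fun \<Rightarrow> nat \<Rightarrow> bool" where
  "boundary_error_negligible \<Omega> h \<Phi> u k \<longleftrightarrow>
    (\<forall>J\<in>space_mesh \<Omega> h. \<forall>i. J - axis i 1 \<notin> space_mesh \<Omega> h \<longrightarrow>
       (\<forall>j. \<Phi> u k (J - axis i 1) $ j $ i = \<Phi> u k J $ j $ i))"

end

theory Submission
  imports Defs
begin

text \<open>
  At a mesh point the vanishing of the discrete system says two things: the lower block gives
  \<open>G = 0\<close>, and then, since \<open>L\<close> is invertible, the upper block is the discrete conservation law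
  \<open>D\<^sub>t \<psi> + D\<^sub>x \<cdot> \<Phi> = 0\<close> (\<open>disc_conservation_law\<close>).

  Summing over the finitely many mesh points, it remains to see that the discrete divergence has
  sum \<open>0\<close>.  In each direction \<open>i\<close> the sum of backward differences telescopes along every run of
  consecutive mesh points, and what is left is the flux at the last point of the run minus the
  flux at the outer neighbour of its first point (\<open>sum_backward_differences_eq_0\<close>).  Both end points
  of a run belong to the mesh boundary, where the flux is \<open>0\<close>, and the outer neighbour carries the
  flux of the first point in direction \<open>i\<close>.
\<close>

section \<open>Finiteness of the mesh\<close>

lemma finite_int_vec_box:
  "finite {J :: int ^ 'n::finite. \<forall>i. \<bar>J $ i\<bar> \<le> N}"
proof (rule finite_imageD)
  have "vec_nth ` {J :: int ^ 'n. \<forall>i. \<bar>J $ i\<bar> \<le> N} \<subseteq> PiE UNIV (\<lambda>_. {-N..N})"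
    by (auto simp: PiE_iff abs_le_iff minus_le_iff)
  moreover have "finite (PiE (UNIV :: 'n set) (\<lambda>_. {-N..N}))"
    by (rule finite_PiE) auto
  ultimately show "finite (vec_nth ` {J :: int ^ 'n. \<forall>i. \<bar>J $ i\<bar> \<le> N})"
    by (rule finite_subset)
  show "inj_on vec_nth {J :: int ^ 'n. \<forall>i. \<bar>J $ i\<bar> \<le> N}"
    by (auto simp: inj_on_def vec_eq_iff)
qed

lemma finite_space_mesh:
  fixes \<Omega> :: "(real ^ 'n::finite) set"
  assumes "bounded \<Omega>" and "h > 0"
  shows "finite (space_mesh \<Omega> h)"
proof -
  obtain B where B: "\<And>x. x \<in> \<Omega> \<Longrightarrow> norm x \<le> B"
    using assms(1) by (auto simp: bounded_iff)
  have "\<bar>J $ i\<bar> \<le> \<lfloor>B / h\<rfloor>" if "J \<in> space_mesh \<Omega> h" for J i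
  proof -
    have "\<bar>mesh_point h J $ i\<bar> \<le> B"
      using component_le_norm_cart[of "mesh_point h J" i] B[of "mesh_point h J"] that
      by (simp add: space_mesh_def)
    then have "of_int \<bar>J $ i\<bar> \<le> B / h"
      using assms(2) by (simp add: mesh_point_def abs_mult field_simps)
    then show ?thesis
      by (simp add: le_floor_iff)
  qed
  then have "space_mesh \<Omega> h \<subseteq> {J. \<forall>i. \<bar>J $ i\<bar> \<le> \<lfloor>B / h\<rfloor>}"
    by auto
  then show ?thesis
    using finite_int_vec_box finite_subset by blast
qed

section \<open>Ends of mesh lines\<close>

text \<open>
  Among the intervals inside \<open>S\<close> that contain \<open>a\<close>, one extended to the least left end and to the
  greatest right end cannot be prolonged.
\<close>

lemma finite_run_through:
  assumes "finite S" and "a \<in> S"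
  obtains \<alpha> \<beta> where "(\<alpha>, \<beta>) \<in> runs S" and "\<alpha> \<le> a" and "a \<le> \<beta>"
proof -
  define A where "A = {b. b \<le> a \<and> {b..a} \<subseteq> S}"
  define B where "B = {b. a \<le> b \<and> {a..b} \<subseteq> S}"
  have fin: "finite A" "finite B"
    by (rule finite_subset[OF _ assms(1)], auto simp: A_def B_def)+
  have "a \<in> A" "a \<in> B"
    using assms(2) by (auto simp: A_def B_def)
  with fin have \<alpha>: "Min A \<in> A" and \<beta>: "Max B \<in> B"
    using Min_in Max_in by blast+
  have "Min A - 1 \<notin> S"
  proof
    assume "Min A - 1 \<in> S"
    moreover have "{Min A - 1..a} \<subseteq> insert (Min A - 1) {Min A..a}"
      by auto
    ultimately have "Min A - 1 \<in> A"
      using \<alpha> by (auto simp: A_def)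
    then show False
      using Min_le[OF fin(1)] by fastforce
  qed
  moreover have "Max B + 1 \<notin> S"
  proof
    assume "Max B + 1 \<in> S"
    moreover have "{a..Max B + 1} \<subseteq> insert (Max B + 1) {a..Max B}"
      by auto
    ultimately have "Max B + 1 \<in> B"
      using \<beta> by (auto simp: B_def)
    then show False
      using Max_ge[OF fin(2)] by fastforce
  qed
  moreover have "{Min A..Max B} \<subseteq> {Min A..a} \<union> {a..Max B}"
    by auto
  then have "{Min A..Max B} \<subseteq> S"
    using \<alpha> \<beta> by (auto simp: A_def B_def)
  ultimately have "(Min A, Max B) \<in> runs S"
    using \<alpha> \<beta> by (auto simp: runs_def A_def B_def)
  then show thesis
    using that \<alpha> \<beta> by (auto simp: A_def B_def)
qed

lemma mem_mesh_line_iff: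
  "j \<in> mesh_line \<Omega> h i J \<longleftrightarrow> J + axis i (j - J $ i) \<in> space_mesh \<Omega> h"
proof -
  have "(\<chi> p. if p = i then j else J $ p) = J + axis i (j - J $ i)"
    by (simp add: vec_eq_iff axis_def)
  then show ?thesis
    by (simp add: mesh_line_def)
qed

lemma finite_mesh_line:
  assumes "finite (space_mesh \<Omega> h)"
  shows "finite (mesh_line \<Omega> h i J)"
proof -
  have "mesh_line \<Omega> h i J \<subseteq> (\<lambda>K. K $ i) ` space_mesh \<Omega> h"
  proof
    fix j assume "j \<in> mesh_line \<Omega> h i J"
    then have "J + axis i (j - J $ i) \<in> space_mesh \<Omega> h"
      by (simp add: mem_mesh_line_iff)
    then show "j \<in> (\<lambda>K. K $ i) ` space_mesh \<Omega> h"
      by (rule rev_image_eqI) (simp add: axis_def)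
  qed
  then show ?thesis
    using assms finite_subset by blast
qed

text \<open>
  The mesh boundary is defined by maximal runs of indices.  What telescoping needs is this local
  criterion: a run through \<open>J\<close> that misses one of the two neighbours must end at \<open>J\<close>.
\<close>

lemma mesh_boundaryI:
  assumes fin: "finite (space_mesh \<Omega> h)" and J: "J \<in> space_mesh \<Omega> h"
    and nb: "J - axis i 1 \<notin> space_mesh \<Omega> h \<or> J + axis i 1 \<notin> space_mesh \<Omega> h"
  shows "J \<in> mesh_boundary \<Omega> h"
proof -
  have minus: "axis i (- 1) = - (axis i 1 :: int ^ 'a)"
    by (simp add: vec_eq_iff axis_def)
  have zero: "axis i 0 = (0 :: int ^ 'a)"
    by (simp add: vec_eq_iff axis_def)
  have "J $ i \<in> mesh_line \<Omega> h i J"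
    using J by (simp add: mem_mesh_line_iff zero)
  then obtain \<alpha> \<beta> where r: "(\<alpha>, \<beta>) \<in> runs (mesh_line \<Omega> h i J)" "\<alpha> \<le> J $ i" "J $ i \<le> \<beta>"
    using finite_run_through[OF finite_mesh_line[OF fin]] by metis
  have "J $ i - 1 \<notin> mesh_line \<Omega> h i J \<or> J $ i + 1 \<notin> mesh_line \<Omega> h i J"
    using nb by (simp add: mem_mesh_line_iff minus)
  moreover have "{\<alpha>..\<beta>} \<subseteq> mesh_line \<Omega> h i J"
    using r(1) by (simp add: runs_def)
  ultimately have "J $ i - 1 \<notin> {\<alpha>..\<beta>} \<or> J $ i + 1 \<notin> {\<alpha>..\<beta>}"
    by blast
  then have "J $ i = \<alpha> \<or> J $ i = \<beta>"
    using r(2,3) by auto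
  then show ?thesis
    using J r(1) by (auto simp: mesh_boundary_def)
qed

section \<open>Telescoping\<close>

text \<open>
  Only steps inside \<open>M\<close> contribute to either sum: the points whose successor leaves \<open>M\<close> and the points
  whose predecessor lies outside \<open>M\<close> give \<open>0\<close>, and the shift by \<open>e\<close> matches the others.
\<close>

lemma sum_backward_differences_eq_0:
  fixes g :: "'a::ab_group_add \<Rightarrow> 'b::ab_group_add"
  assumes fin: "finite M"
    and last: "\<And>x. x \<in> M \<Longrightarrow> x + e \<notin> M \<Longrightarrow> g x = 0"
    and first: "\<And>x. x \<in> M \<Longrightarrow> x - e \<notin> M \<Longrightarrow> g (x - e) = 0"
  shows "(\<Sum>x\<in>M. g x - g (x - e)) = 0"
proof -
  have "(\<Sum>x\<in>M. g (x - e)) = (\<Sum>x\<in>{x\<in>M. x - e \<in> M}. g (x - e))"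
    by (rule sum.mono_neutral_right) (use fin first in auto)
  also have "\<dots> = (\<Sum>x\<in>{x\<in>M. x + e \<in> M}. g x)"
    by (rule sum.reindex_bij_witness[of _ "\<lambda>x. x + e" "\<lambda>x. x - e"]) auto
  also have "\<dots> = (\<Sum>x\<in>M. g x)"
    by (rule sum.mono_neutral_left) (use fin last in auto)
  finally show ?thesis
    by (simp add: sum_subtractf)
qed

lemma sum_disc_div_eq_0:
  fixes \<Phi> :: "('n::finite, 'm::finite, real ^ 'n ^ 's::finite) mesh_expr"
  assumes fin: "finite (space_mesh \<Omega> h)"
    and negl: "boundary_error_negligible \<Omega> h \<Phi> u k"
    and van: "fluxes_vanish_on_boundary \<Omega> h \<Phi> u k"
  shows "(\<Sum>J\<in>space_mesh \<Omega> h. disc_div h \<Phi> u k J) = 0"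
proof -
  have bd: "\<Phi> u k J = 0"
    if "J \<in> space_mesh \<Omega> h"
      and "J - axis i 1 \<notin> space_mesh \<Omega> h \<or> J + axis i 1 \<notin> space_mesh \<Omega> h" for J i
    using van mesh_boundaryI[OF fin that] by (simp add: fluxes_vanish_on_boundary_def)
  have dir: "(\<Sum>J\<in>space_mesh \<Omega> h. \<Phi> u k J $ j $ i - \<Phi> u k (J - axis i 1) $ j $ i) = 0" for i j
  proof (rule sum_backward_differences_eq_0[OF fin])
    fix J assume J: "J \<in> space_mesh \<Omega> h"
    show "\<Phi> u k J $ j $ i = 0" if "J + axis i 1 \<notin> space_mesh \<Omega> h"
      using bd[OF J, of i] that by simp
    show "\<Phi> u k (J - axis i 1) $ j $ i = 0" if "J - axis i 1 \<notin> space_mesh \<Omega> h"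
      using negl bd[OF J, of i] J that by (simp add: boundary_error_negligible_def)
  qed
  have "(\<Sum>J\<in>space_mesh \<Omega> h. disc_div h \<Phi> u k J) $ j = 0" for j
  proof -
    have "(\<Sum>J\<in>space_mesh \<Omega> h. disc_div h \<Phi> u k J) $ j =
        (\<Sum>i\<in>UNIV. \<Sum>J\<in>space_mesh \<Omega> h. (\<Phi> u k J $ j $ i - \<Phi> u k (J - axis i 1) $ j $ i) / h)"
      unfolding sum_component disc_div_def vec_lambda_beta by (rule sum.swap)
    also have "\<dots> = 0"
      by (simp add: sum_divide_distrib[symmetric] dir)
    finally show ?thesis .
  qed
  then show ?thesis
    by (simp add: vec_eq_iff)
qed

section \<open>Discrete conservation law\<close>

lemma block_vec_eq_0_iff: "block_vec v w = 0 \<longleftrightarrow> v = 0 \<and> w = 0"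
proof
  assume "block_vec v w = 0"
  then have "block_vec v w $ Inl a = 0" "block_vec v w $ Inr b = 0" for a b
    by simp_all
  then show "v = 0 \<and> w = 0"
    by (simp add: block_vec_def vec_eq_iff)
qed (simp add: block_vec_def vec_eq_iff split: sum.split)

lemma matrix_inv_right:
  fixes A :: "'a::semiring_1 ^ 'n ^ 'm"
  assumes "invertible A"
  shows "A ** matrix_inv A = mat 1"
  using someI_ex[OF assms[unfolded invertible_def]] by (simp add: matrix_inv_def)

text \<open>
  The scheme is solved for the first \<open>s\<close> equations, so multiplying by \<open>L\<close> recovers the conservation
  law up to the term \<open>S *v G\<close>, which the remaining equations annihilate.
\<close>

lemma disc_conservation_law:
  assumes "invertible (L u k J)" and "disc_F \<tau> h L S G \<psi> \<Phi> u k J = 0"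
  shows "disc_Dt \<tau> \<psi> u k J + disc_div h \<Phi> u k J = 0"
proof -
  let ?v = "disc_Dt \<tau> \<psi> u k J + disc_div h \<Phi> u k J"
  have "G u k J = 0" and "matrix_inv (L u k J) *v (?v - S u k J *v G u k J) = 0"
    using assms(2) unfolding disc_F_def block_vec_eq_0_iff by blast+
  then have "matrix_inv (L u k J) *v ?v = 0"
    by (simp only: matrix_vector_mult_0_right diff_zero)
  then have "(L u k J ** matrix_inv (L u k J)) *v ?v = 0"
    by (simp add: matrix_vector_mul_assoc[symmetric])
  then show ?thesis
    using assms(1) by (simp add: matrix_inv_right)
qed

theorem corollary3:
  fixes T \<tau> h :: real
    and \<Omega> :: "(real ^ 'n::finite) set"
    and F :: "('n, 's::finite + 'r::finite, real ^ ('s + 'r)) dfun"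
    and L :: "('n, 's + 'r, real ^ 's ^ 's) dfun"
    and S :: "('n, 's + 'r, real ^ 'r ^ 's) dfun"
    and G :: "('n, 's + 'r, real ^ 'r) dfun"
    and \<psi> :: "('n, 's + 'r, real ^ 's) dfun"
    and \<Phi> :: "('n, 's + 'r, real ^ 'n ^ 's) dfun"
    and Lh :: "('n, 's + 'r, real ^ 's ^ 's) mesh_expr"
    and Sh :: "('n, 's + 'r, real ^ 'r ^ 's) mesh_expr"
    and Gh :: "('n, 's + 'r, real ^ 'r) mesh_expr"
    and \<psi>h :: "('n, 's + 'r, real ^ 's) mesh_expr"
    and \<Phi>h :: "('n, 's + 'r, real ^ 'n ^ 's) mesh_expr"
    and u :: "('n, 's + 'r) mesh_fun"
    and k :: nat
  assumes "T > 0" and "\<tau> > 0" and "h > 0"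
    and "open \<Omega>" and "connected \<Omega>" and "bounded \<Omega>" and "\<Omega> \<noteq> {}"
    and "differential_function F"
    and "conservation_law_multipliers {0<..<T} \<Omega>
           (\<lambda>t x z. block_row (L t x z) (S t x z)) F \<psi> \<Phi>"
    and "G = (\<lambda>t x z. last_entries (F t x z))"
    and "fd_discretization T \<tau> \<Omega> h Lh"
    and "fd_discretization T \<tau> \<Omega> h Sh"
    and "fd_discretization T \<tau> \<Omega> h Gh"
    and "fd_discretization T \<tau> \<Omega> h \<psi>h"
    and "fd_discretization T \<tau> \<Omega> h \<Phi>h"
    and "k \<in> time_mesh T \<tau>" and "k \<ge> 1"
    and "\<forall>J\<in>space_mesh \<Omega> h. invertible (Lh u k J)"
    and "\<forall>J\<in>space_mesh \<Omega> h. disc_F \<tau> h Lh Sh Gh \<psi>h \<Phi>h u k J = 0"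
    and "boundary_error_negligible \<Omega> h \<Phi>h u k"
    and "fluxes_vanish_on_boundary \<Omega> h \<Phi>h u k"
  shows "(\<Sum>J\<in>space_mesh \<Omega> h. \<psi>h u k J) = (\<Sum>J\<in>space_mesh \<Omega> h. \<psi>h u (k - 1) J)"
proof -
  let ?M = "space_mesh \<Omega> h"
  have fin: "finite ?M"
    using \<open>bounded \<Omega>\<close> \<open>h > 0\<close> by (rule finite_space_mesh)
  have "(\<Sum>J\<in>?M. disc_Dt \<tau> \<psi>h u k J + disc_div h \<Phi>h u k J) = 0"
    using \<open>\<forall>J\<in>?M. invertible (Lh u k J)\<close>
      \<open>\<forall>J\<in>?M. disc_F \<tau> h Lh Sh Gh \<psi>h \<Phi>h u k J = 0\<close>
    by (intro sum.neutral ballI disc_conservation_law) auto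
  then have "(\<Sum>J\<in>?M. disc_Dt \<tau> \<psi>h u k J) = 0"
    using sum_disc_div_eq_0[OF fin \<open>boundary_error_negligible \<Omega> h \<Phi>h u k\<close>
        \<open>fluxes_vanish_on_boundary \<Omega> h \<Phi>h u k\<close>]
    by (simp add: sum.distrib)
  then have "((\<Sum>J\<in>?M. \<psi>h u k J) - (\<Sum>J\<in>?M. \<psi>h u (k - 1) J)) /\<^sub>R \<tau> = 0"
    by (simp add: disc_Dt_def scaleR_sum_right[symmetric] sum_subtractf)
  then show ?thesis
    using \<open>\<tau> > 0\<close> by simp
qed

end
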